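(* Let $n\ge1$ and let $\mathcal V_n$ be the real nilpotent Lie algebra with basis $e_1,\dots,e_n$ and commutation relations $[e_i,e_j]=(j-i)e_{i+j}$ if $i+j\le n$ and $[e_i,e_j]=0$ if $i+j>n$. Then $\mathcal V_n$ has step $k$ as a solvable Lie algebra, where $k$ is determined by $$2^k-1\le n<2^{k+1}-1 .$$
   Context: For a Lie algebra $\mathfrak g$ put $D^0\mathfrak g=\mathfrak g$ and $D^{i}\mathfrak g=[D^{i-1}\mathfrak g,D^{i-1}\mathfrak g]$ for $i\ge1$. The Lie algebra $\mathfrak g$ is solvable of step $k$ if $D^k\mathfrak g=0$ and $D^{k-1}\mathfrak g\ne0$. *)

theory Defs
  imports "HOL-Analysis.Finite_Function_Topology"
begin

text \<open>A real Lie algebra is carried by a linear subspace of an ambient real vector space, so that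
  algebras of every finite dimension live over one and the same type.  The bracket is a total
  function of which only the values on the carrier matter.\<close>

locale real_lie_algebra =
  fixes L :: "'a::real_vector set" and bracket :: "'a \<Rightarrow> 'a \<Rightarrow> 'a"
  assumes carrier_subspace: "subspace L"
    and bracket_closed: "\<lbrakk>x \<in> L; y \<in> L\<rbrakk> \<Longrightarrow> bracket x y \<in> L"
    and bracket_add_left: "\<lbrakk>x \<in> L; y \<in> L; z \<in> L\<rbrakk> \<Longrightarrow> bracket (x + y) z = bracket x z + bracket y z"
    and bracket_add_right: "\<lbrakk>x \<in> L; y \<in> L; z \<in> L\<rbrakk> \<Longrightarrow> bracket x (y + z) = bracket x y + bracket x z"
    and bracket_scale_left: "\<lbrakk>x \<in> L; y \<in> L\<rbrakk> \<Longrightarrow> bracket (c *\<^sub>R x) y = c *\<^sub>R bracket x y"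
    and bracket_scale_right: "\<lbrakk>x \<in> L; y \<in> L\<rbrakk> \<Longrightarrow> bracket x (c *\<^sub>R y) = c *\<^sub>R bracket x y"
    and bracket_alternating: "x \<in> L \<Longrightarrow> bracket x x = 0"
    and jacobi: "\<lbrakk>x \<in> L; y \<in> L; z \<in> L\<rbrakk> \<Longrightarrow>
      bracket x (bracket y z) + bracket y (bracket z x) + bracket z (bracket x y) = 0"

definition lie_product ::
    "('a::real_vector \<Rightarrow> 'a \<Rightarrow> 'a) \<Rightarrow> 'a set \<Rightarrow> 'a set \<Rightarrow> 'a set" where
  "lie_product bracket A B = span {bracket x y |x y. x \<in> A \<and> y \<in> B}"

primrec derived_series ::
    "'a::real_vector set \<Rightarrow> ('a \<Rightarrow> 'a \<Rightarrow> 'a) \<Rightarrow> nat \<Rightarrow> 'a set" where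
  "derived_series L bracket 0 = L"
| "derived_series L bracket (Suc i) =
     lie_product bracket (derived_series L bracket i) (derived_series L bracket i)"

primrec lower_central_series ::
    "'a::real_vector set \<Rightarrow> ('a \<Rightarrow> 'a \<Rightarrow> 'a) \<Rightarrow> nat \<Rightarrow> 'a set" where
  "lower_central_series L bracket 0 = L"
| "lower_central_series L bracket (Suc i) =
     lie_product bracket L (lower_central_series L bracket i)"

definition lie_nilpotent :: "'a::real_vector set \<Rightarrow> ('a \<Rightarrow> 'a \<Rightarrow> 'a) \<Rightarrow> bool" where
  "lie_nilpotent L bracket \<longleftrightarrow> (\<exists>i. lower_central_series L bracket i = {0})"

text \<open>The condition \<open>1 \<le> k\<close> keeps \<open>k - 1\<close> from being truncated to \<open>0\<close>.\<close>

definition solvable_of_step :: "'a::real_vector set \<Rightarrow> ('a \<Rightarrow> 'a \<Rightarrow> 'a) \<Rightarrow> nat \<Rightarrow> bool" where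
  "solvable_of_step L bracket k \<longleftrightarrow>
     1 \<le> k \<and> derived_series L bracket k = {0} \<and> derived_series L bracket (k - 1) \<noteq> {0}"

text \<open>\<open>(L, bracket)\<close> is the algebra \<open>\<V>\<^sub>n\<close> with the distinguished basis \<open>e 1, \<dots>, e n\<close>; the values
  of \<open>e\<close> outside \<open>{1..n}\<close> are irrelevant.  These axioms determine the algebra up to isomorphism,
  and lemma \<open>V_algebra_model\<close> below shows that they can be satisfied for every \<open>n\<close>.\<close>

locale V_algebra = real_lie_algebra L bracket
  for L :: "'a::real_vector set" and bracket :: "'a \<Rightarrow> 'a \<Rightarrow> 'a" +
  fixes n :: nat and e :: "nat \<Rightarrow> 'a"
  assumes basis_inj: "inj_on e {1..n}"
    and basis_independent: "independent (e ` {1..n})"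
    and basis_span: "span (e ` {1..n}) = L"
    and relations: "\<lbrakk>i \<in> {1..n}; j \<in> {1..n}; i + j \<le> n\<rbrakk> \<Longrightarrow>
      bracket (e i) (e j) = (real j - real i) *\<^sub>R e (i + j)"
    and relations_zero: "\<lbrakk>i \<in> {1..n}; j \<in> {1..n}; n < i + j\<rbrakk> \<Longrightarrow> bracket (e i) (e j) = 0"

text \<open>A model, in the free real vector space on \<open>nat\<close>: the bracket is the bilinear extension of the
  defining relations.\<close>

definition V_gen :: "nat \<Rightarrow> (nat \<Rightarrow>\<^sub>0 real)" where
  "V_gen i = Poly_Mapping.single i 1"

definition V_trunc :: "nat \<Rightarrow> nat \<Rightarrow> (nat \<Rightarrow>\<^sub>0 real)" where
  "V_trunc n m = (if m \<le> n then V_gen m else 0)"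

definition V_bracket :: "nat \<Rightarrow> (nat \<Rightarrow>\<^sub>0 real) \<Rightarrow> (nat \<Rightarrow>\<^sub>0 real) \<Rightarrow> (nat \<Rightarrow>\<^sub>0 real)" where
  "V_bracket n x y = (\<Sum>i\<in>{1..n}. \<Sum>j\<in>{1..n}.
     (Poly_Mapping.lookup x i * Poly_Mapping.lookup y j * (real j - real i)) *\<^sub>R V_trunc n (i + j))"

lemma lookup_scaleR [simp]:
  "Poly_Mapping.lookup (c *\<^sub>R x) i = c *\<^sub>R Poly_Mapping.lookup (x :: (nat \<Rightarrow>\<^sub>0 real)) i"
proof -
  have "{i. c *\<^sub>R Poly_Mapping.lookup x i \<noteq> 0} \<subseteq> {i. Poly_Mapping.lookup x i \<noteq> 0}"
    by auto
  then have "finite {i. c *\<^sub>R Poly_Mapping.lookup x i \<noteq> 0}"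
    using finite_lookup finite_subset by blast
  then show ?thesis
    by (simp add: scaleR_poly_mapping_def Abs_poly_mapping_inverse)
qed

lemma lookup_V_gen: "Poly_Mapping.lookup (V_gen i) j = (if i = j then 1 else 0)"
  by (simp add: V_gen_def lookup_single when_def)

lemma V_bracket_add_left: "V_bracket n (x + y) z = V_bracket n x z + V_bracket n y z"
  by (simp add: V_bracket_def lookup_add algebra_simps flip: sum.distrib)

lemma V_bracket_scale_left: "V_bracket n (c *\<^sub>R x) y = c *\<^sub>R V_bracket n x y"
  by (simp add: V_bracket_def scaleR_sum_right mult.assoc)

lemma V_bracket_anti: "V_bracket n y x = - V_bracket n x y"
proof -
  have "V_bracket n y x = (\<Sum>i\<in>{1..n}. \<Sum>j\<in>{1..n}.
     (Poly_Mapping.lookup y j * Poly_Mapping.lookup x i * (real i - real j)) *\<^sub>R V_trunc n (j + i))"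
    unfolding V_bracket_def by (rule sum.swap)
  also have "\<dots> = - V_bracket n x y"
    unfolding V_bracket_def sum_negf [symmetric] scaleR_minus_left [symmetric]
    by (intro sum.cong refl arg_cong2[where f = scaleR]) (auto simp: algebra_simps)
  finally show ?thesis .
qed

lemma V_bracket_add_right: "V_bracket n x (y + z) = V_bracket n x y + V_bracket n x z"
  by (metis V_bracket_add_left V_bracket_anti minus_add_distrib)

lemma V_bracket_scale_right: "V_bracket n x (c *\<^sub>R y) = c *\<^sub>R V_bracket n x y"
  by (metis V_bracket_scale_left V_bracket_anti scaleR_minus_right)

lemma V_bracket_self: "V_bracket n x x = 0"
proof -
  have "2 *\<^sub>R V_bracket n x x = 0"
    using V_bracket_anti [of n x x] by (simp add: scaleR_2 eq_neg_iff_add_eq_0)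
  then show ?thesis by simp
qed

lemma V_bracket_sum_right: "V_bracket n x (sum f S) = (\<Sum>s\<in>S. V_bracket n x (f s))"
proof -
  have "Modules.additive (V_bracket n x)"
    by (simp add: Modules.additive_def V_bracket_add_right)
  then show ?thesis by (rule Modules.additive.sum)
qed

lemma V_bracket_trunc:
  assumes "1 \<le> m"
  shows "V_bracket n x (V_trunc n m)
    = (\<Sum>i\<in>{1..n}. (Poly_Mapping.lookup x i * (real m - real i)) *\<^sub>R V_trunc n (i + m))"
proof (cases "m \<le> n")
  case True
  have "(\<Sum>j\<in>{1..n}. (Poly_Mapping.lookup x i * Poly_Mapping.lookup (V_gen m) j * (real j - real i))
        *\<^sub>R V_trunc n (i + j))
      = (Poly_Mapping.lookup x i * (real m - real i)) *\<^sub>R V_trunc n (i + m)" for i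
  proof -
    have "(\<Sum>j\<in>{1..n}. (Poly_Mapping.lookup x i * Poly_Mapping.lookup (V_gen m) j * (real j - real i))
        *\<^sub>R V_trunc n (i + j))
      = (\<Sum>j\<in>{1..n}. if m = j then (Poly_Mapping.lookup x i * (real j - real i)) *\<^sub>R V_trunc n (i + j)
          else 0)"
      by (intro sum.cong) (auto simp: lookup_V_gen)
    then show ?thesis using True assms by simp
  qed
  then show ?thesis using True by (simp add: V_bracket_def V_trunc_def [of n m])
next
  case False
  then show ?thesis by (simp add: V_bracket_def V_trunc_def)
qed

definition V_cubic :: "nat \<Rightarrow> (nat \<Rightarrow>\<^sub>0 real) \<Rightarrow> (nat \<Rightarrow>\<^sub>0 real) \<Rightarrow> (nat \<Rightarrow>\<^sub>0 real)
    \<Rightarrow> (nat \<Rightarrow> nat \<Rightarrow> nat \<Rightarrow> real) \<Rightarrow> (nat \<Rightarrow>\<^sub>0 real)" where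
  "V_cubic n x y z c = (\<Sum>i\<in>{1..n}. \<Sum>j\<in>{1..n}. \<Sum>k\<in>{1..n}.
     (Poly_Mapping.lookup x i * Poly_Mapping.lookup y j * Poly_Mapping.lookup z k * c i j k)
       *\<^sub>R V_trunc n (i + j + k))"

lemma V_bracket_bracket:
  "V_bracket n x (V_bracket n y z)
     = V_cubic n x y z (\<lambda>i j k. (real k - real j) * (real j + real k - real i))"
proof -
  have "V_bracket n x (V_bracket n y z) = (\<Sum>j\<in>{1..n}. \<Sum>k\<in>{1..n}. \<Sum>i\<in>{1..n}.
     (Poly_Mapping.lookup x i * Poly_Mapping.lookup y j * Poly_Mapping.lookup z k
        * ((real k - real j) * (real j + real k - real i))) *\<^sub>R V_trunc n (i + j + k))"
    unfolding V_bracket_def [of n y z] V_bracket_sum_right V_bracket_scale_right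
    by (intro sum.cong refl)
       (auto simp: V_bracket_trunc scaleR_sum_right add.assoc intro!: sum.cong arg_cong2[where f = scaleR])
  also have "\<dots> = (\<Sum>j\<in>{1..n}. \<Sum>i\<in>{1..n}. \<Sum>k\<in>{1..n}.
     (Poly_Mapping.lookup x i * Poly_Mapping.lookup y j * Poly_Mapping.lookup z k
        * ((real k - real j) * (real j + real k - real i))) *\<^sub>R V_trunc n (i + j + k))"
    by (intro sum.cong refl sum.swap)
  also have "\<dots> = V_cubic n x y z (\<lambda>i j k. (real k - real j) * (real j + real k - real i))"
    unfolding V_cubic_def by (rule sum.swap)
  finally show ?thesis .
qed

lemma V_cubic_rotate: "V_cubic n y z x c = V_cubic n x y z (\<lambda>i j k. c j k i)"
proof -
  have "V_cubic n y z x c = (\<Sum>j\<in>{1..n}. \<Sum>i\<in>{1..n}. \<Sum>k\<in>{1..n}.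
     (Poly_Mapping.lookup y j * Poly_Mapping.lookup z k * Poly_Mapping.lookup x i * c j k i)
       *\<^sub>R V_trunc n (j + k + i))"
    unfolding V_cubic_def by (intro sum.cong refl sum.swap)
  also have "\<dots> = (\<Sum>i\<in>{1..n}. \<Sum>j\<in>{1..n}. \<Sum>k\<in>{1..n}.
     (Poly_Mapping.lookup y j * Poly_Mapping.lookup z k * Poly_Mapping.lookup x i * c j k i)
       *\<^sub>R V_trunc n (j + k + i))"
    by (rule sum.swap)
  also have "\<dots> = V_cubic n x y z (\<lambda>i j k. c j k i)"
    unfolding V_cubic_def by (intro sum.cong refl) (simp add: ac_simps)
  finally show ?thesis .
qed

lemma V_cubic_add: "V_cubic n x y z c + V_cubic n x y z d = V_cubic n x y z (\<lambda>i j k. c i j k + d i j k)"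
  by (simp add: V_cubic_def distrib_left scaleR_add_left sum.distrib)

lemma V_bracket_jacobi:
  "V_bracket n x (V_bracket n y z) + V_bracket n y (V_bracket n z x) + V_bracket n z (V_bracket n x y) = 0"
proof -
  have "V_cubic n z x y c = V_cubic n x y z (\<lambda>i j k. c k i j)" for c
    by (simp add: V_cubic_rotate [of n z x y] V_cubic_rotate [of n y z x])
  then have "V_bracket n x (V_bracket n y z) + V_bracket n y (V_bracket n z x)
      + V_bracket n z (V_bracket n x y) = V_cubic n x y z (\<lambda>i j k.
        (real k - real j) * (real j + real k - real i) + (real i - real k) * (real k + real i - real j)
        + (real j - real i) * (real i + real j - real k))"
    by (simp add: V_bracket_bracket V_cubic_rotate [of n y z x] V_cubic_add)
  also have "(\<lambda>i j k.
        (real k - real j) * (real j + real k - real i) + (real i - real k) * (real k + real i - real j)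
        + (real j - real i) * (real i + real j - real k)) = (\<lambda>i j k. 0)"
    by (intro ext) algebra
  also have "V_cubic n x y z (\<lambda>i j k. 0) = 0"
    by (simp add: V_cubic_def)
  finally show ?thesis .
qed

lemma inj_V_gen: "inj V_gen"
  by (rule injI) (metis lookup_V_gen zero_neq_one)

lemma V_gen_notin_span:
  assumes "i \<notin> S"
  shows "V_gen i \<notin> span (V_gen ` S)"
proof
  assume "V_gen i \<in> span (V_gen ` S)"
  moreover have "subspace {x :: (nat \<Rightarrow>\<^sub>0 real). Poly_Mapping.lookup x i = 0}"
    by (auto simp: subspace_def lookup_add)
  moreover have "V_gen ` S \<subseteq> {x. Poly_Mapping.lookup x i = 0}"
    using assms by (auto simp: lookup_V_gen)
  ultimately have "Poly_Mapping.lookup (V_gen i) i = 0"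
    using span_minimal by blast
  then show False by (simp add: lookup_V_gen)
qed

lemma independent_V_gen: "independent (V_gen ` S)"
  unfolding dependent_def
proof clarify
  fix i assume "i \<in> S" and *: "V_gen i \<in> span (V_gen ` S - {V_gen i})"
  have "V_gen ` S - {V_gen i} = V_gen ` (S - {i})"
    using inj_V_gen by (auto simp: inj_eq)
  with * show False using V_gen_notin_span [of i "S - {i}"] by auto
qed

lemma V_bracket_gen:
  assumes "i \<in> {1..n}" "j \<in> {1..n}"
  shows "V_bracket n (V_gen i) (V_gen j) = (real j - real i) *\<^sub>R V_trunc n (i + j)"
proof -
  have "V_bracket n (V_gen i) (V_gen j) = V_bracket n (V_gen i) (V_trunc n j)"
    using assms by (simp add: V_trunc_def)
  also have "\<dots> = (\<Sum>k\<in>{1..n}.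
      (Poly_Mapping.lookup (V_gen i) k * (real j - real k)) *\<^sub>R V_trunc n (k + j))"
    using assms by (intro V_bracket_trunc) simp
  also have "\<dots> = (\<Sum>k\<in>{1..n}.
      if i = k then (real j - real k) *\<^sub>R V_trunc n (k + j) else 0)"
    by (intro sum.cong) (auto simp: lookup_V_gen)
  finally show ?thesis using assms by simp
qed

lemma V_algebra_model: "V_algebra (span (V_gen ` {1..n})) (V_bracket n) n V_gen"
proof
  show "V_bracket n x y \<in> span (V_gen ` {1..n})" for x y
    unfolding V_bracket_def
    by (intro span_sum span_scale) (auto simp: V_trunc_def span_zero intro!: span_base)
  show "inj_on V_gen {1..n}"
    using inj_V_gen by (rule inj_on_subset) simp
qed (simp_all add: V_bracket_add_left V_bracket_add_right V_bracket_scale_left V_bracket_scale_right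
    V_bracket_self V_bracket_jacobi independent_V_gen V_bracket_gen V_trunc_def)

end

theory Submission
  imports Defs
begin

text \<open>The algebra is filtered by the tails \<open>\<langle>e\<^sub>m, \<dots>, e\<^sub>n\<rangle>\<close>, and every term of the derived series is
  such a tail.  The bracket of two elements of the tail from \<open>m\<close> has no component below \<open>e\<^sub>2\<^sub>m\<close>, and
  the coefficient of \<open>e\<^sub>2\<^sub>m\<close> vanishes as well, because it can only come from \<open>[e\<^sub>m, e\<^sub>m] = 0\<close>.  From
  \<open>2m + 1\<close> on nothing else is lost: for \<open>2m + 1 \<le> j \<le> n\<close> the factor in
  \<open>[e\<^sub>m, e\<^sub>j\<^sub>-\<^sub>m] = (j - 2m) e\<^sub>j\<close> is not zero.  So one step of the derived series replaces \<open>m\<close> by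
  \<open>2m + 1\<close>, that is, it doubles \<open>m + 1\<close> (\<open>lie_product_tail\<close>).  Starting from \<open>m = 1\<close>, the \<open>i\<close>-th
  term is the tail from \<open>2\<^bsup>i+1\<^esup> - 1\<close> (\<open>derived_series_eq_tail\<close>), which is zero exactly when
  \<open>n < 2\<^bsup>i+1\<^esup> - 1\<close>.  The step is therefore the number \<open>k\<close> with \<open>2\<^bsup>k\<^esup> - 1 \<le> n < 2\<^bsup>k+1\<^esup> - 1\<close>.

  Nilpotency follows from the same filtration, since bracketing with any element
  raises the index of a tail by at least one.\<close>

context real_lie_algebra
begin

lemma bracket_zero_left: "y \<in> L \<Longrightarrow> bracket 0 y = 0"
  using bracket_scale_left [of y y 0] by simp

lemma bracket_zero_right: "x \<in> L \<Longrightarrow> bracket x 0 = 0"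
  using bracket_scale_right [of x x 0] by simp

text \<open>Bilinearity is used in one argument at a time: for fixed \<open>x \<in> L\<close> the elements \<open>y \<in> L\<close> with
  \<open>bracket x y \<in> S\<close> form a subspace.  They have to be taken inside \<open>L\<close>, since the total function
  \<open>bracket\<close> is linear only there.\<close>

lemma bracket_span_in_subspace:
  assumes "X \<subseteq> L" "Y \<subseteq> L" "subspace S"
    and gen: "\<And>x y. \<lbrakk>x \<in> X; y \<in> Y\<rbrakk> \<Longrightarrow> bracket x y \<in> S"
    and "x \<in> span X" "y \<in> span Y"
  shows "bracket x y \<in> S"
proof -
  have right: "bracket u v \<in> S" if "u \<in> X" "v \<in> span Y" for u v
  proof -
    have "subspace {v \<in> L. bracket u v \<in> S}"
      using that(1) assms(1,3) carrier_subspace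
      by (auto simp: subspace_def bracket_zero_right bracket_add_right bracket_scale_right subset_iff)
    then have "span Y \<subseteq> {v \<in> L. bracket u v \<in> S}"
      using that(1) assms(2) gen by (intro span_minimal) auto
    with that(2) show ?thesis by auto
  qed
  have yL: "y \<in> L"
    using assms(2,6) carrier_subspace span_minimal by blast
  have "subspace {u \<in> L. bracket u y \<in> S}"
    using yL assms(3) carrier_subspace
    by (auto simp: subspace_def bracket_zero_left bracket_add_left bracket_scale_left)
  then have "span X \<subseteq> {u \<in> L. bracket u y \<in> S}"
    using assms(1,6) right by (intro span_minimal) auto
  with assms(5) show ?thesis by auto
qed

lemma lie_product_span:
  assumes "X \<subseteq> L" "Y \<subseteq> L"
  shows "lie_product bracket (span X) (span Y) = span {bracket x y |x y. x \<in> X \<and> y \<in> Y}"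
    (is "_ = span ?G")
proof
  have "bracket x y \<in> span ?G" if "x \<in> span X" "y \<in> span Y" for x y
    using assms subspace_span [of ?G] _ that
    by (rule bracket_span_in_subspace) (blast intro: span_base)
  then show "lie_product bracket (span X) (span Y) \<subseteq> span ?G"
    unfolding lie_product_def by (intro span_minimal subspace_span) auto
  show "span ?G \<subseteq> lie_product bracket (span X) (span Y)"
    unfolding lie_product_def by (intro span_mono) (auto intro: span_base)
qed

end

context V_algebra
begin

definition tail :: "nat \<Rightarrow> 'a set" where
  "tail m = span (e ` {m..n})"

lemma basis_in_tail: "\<lbrakk>m \<le> j; j \<le> n\<rbrakk> \<Longrightarrow> e j \<in> tail m"
  by (simp add: tail_def span_base)

lemma subspace_tail: "subspace (tail m)"
  by (simp add: tail_def)

lemma basis_in_carrier: "1 \<le> m \<Longrightarrow> e ` {m..n} \<subseteq> L"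
  using basis_span by (auto intro: span_base)

lemma carrier_eq_tail: "L = tail 1"
  using basis_span by (simp add: tail_def)

lemma tail_eq_zero_iff:
  assumes "1 \<le> m"
  shows "tail m = {0} \<longleftrightarrow> n < m"
proof
  assume *: "tail m = {0}"
  show "n < m"
  proof (rule ccontr)
    assume "\<not> n < m"
    then have "e m = 0" and "e m \<in> e ` {1..n}"
      using * basis_in_tail [of m m] assms by auto
    with basis_independent show False
      using dependent_zero by metis
  qed
qed (simp add: tail_def)

lemma lie_product_tail_eq_span:
  assumes "1 \<le> a" "1 \<le> b"
  shows "lie_product bracket (tail a) (tail b)
    = span {bracket (e i) (e j) |i j. i \<in> {a..n} \<and> j \<in> {b..n}}"
proof -
  have "{bracket x y |x y. x \<in> e ` {a..n} \<and> y \<in> e ` {b..n}}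
      = {bracket (e i) (e j) |i j. i \<in> {a..n} \<and> j \<in> {b..n}}"
    by blast
  then show ?thesis
    using lie_product_span [OF basis_in_carrier [OF assms(1)] basis_in_carrier [OF assms(2)]]
    by (simp add: tail_def)
qed

text \<open>The bound on \<open>i + j\<close> is asked for only when \<open>i \<noteq> j\<close>, because \<open>[e\<^sub>i, e\<^sub>i] = 0\<close>.  For distinct
  indices from \<open>m\<close> on, the sum is at least \<open>2m + 1\<close> rather than only \<open>2m\<close>; this is what makes
  \<open>m + 1\<close> double along the derived series.\<close>

lemma bracket_basis_in_tail:
  assumes "i \<in> {1..n}" "j \<in> {1..n}" "i \<noteq> j \<Longrightarrow> m \<le> i + j"
  shows "bracket (e i) (e j) \<in> tail m"
proof (cases "i = j \<or> n < i + j")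
  case True
  then have "bracket (e i) (e j) = 0"
    using assms(1,2) basis_in_carrier [of 1] relations_zero [of i j] bracket_alternating [of "e i"]
    by blast
  then show ?thesis using subspace_tail subspace_0 by metis
next
  case False
  then show ?thesis
    using assms relations [of i j] by (simp add: subspace_scale [OF subspace_tail] basis_in_tail)
qed

lemma lie_product_tail:
  assumes "1 \<le> m"
  shows "lie_product bracket (tail m) (tail m) = tail (2 * m + 1)"
proof
  show "lie_product bracket (tail m) (tail m) \<subseteq> tail (2 * m + 1)"
    unfolding lie_product_tail_eq_span [OF assms assms]
    using assms by (intro span_minimal subspace_tail) (auto intro!: bracket_basis_in_tail)
  have "e j \<in> lie_product bracket (tail m) (tail m)" if j: "j \<in> {2 * m + 1..n}" for j
  proof -
    have "m \<in> {1..n}" "j - m \<in> {1..n}" "m + (j - m) = j"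
      "real (j - m) - real m = real j - 2 * real m"
      using j assms by auto
    then have "bracket (e m) (e (j - m)) = (real j - 2 * real m) *\<^sub>R e j"
      using relations [of m "j - m"] j by simp
    moreover have "real j - 2 * real m \<noteq> 0"
      using j by auto
    ultimately have e_j: "e j = inverse (real j - 2 * real m) *\<^sub>R bracket (e m) (e (j - m))"
      by simp
    have "e m \<in> tail m" "e (j - m) \<in> tail m"
      using j by (auto intro: basis_in_tail)
    then have "bracket (e m) (e (j - m)) \<in> lie_product bracket (tail m) (tail m)"
      unfolding lie_product_def by (blast intro: span_base)
    then show ?thesis
      unfolding lie_product_def by (subst e_j) (rule span_scale)
  qed
  then show "tail (2 * m + 1) \<subseteq> lie_product bracket (tail m) (tail m)"
    unfolding tail_def [of "2 * m + 1"] lie_product_def by (intro span_minimal) auto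
qed

lemma derived_series_eq_tail: "derived_series L bracket i = tail (2 ^ (i + 1) - 1)"
proof (induction i)
  case 0
  show ?case by (simp add: carrier_eq_tail)
next
  case (Suc i)
  have "1 \<le> (2::nat) ^ i" by simp
  then have "1 \<le> (2::nat) ^ (i + 1) - 1" "2 * (2 ^ (i + 1) - 1) + 1 = (2::nat) ^ (Suc i + 1) - 1"
    unfolding power_Suc Suc_eq_plus1 [symmetric] by linarith+
  with Suc lie_product_tail show ?case by simp
qed

lemma derived_series_eq_zero_iff: "derived_series L bracket i = {0} \<longleftrightarrow> n < 2 ^ (i + 1) - 1"
proof -
  have "1 \<le> (2::nat) ^ i" by simp
  then have "1 \<le> (2::nat) ^ (i + 1) - 1"
    unfolding power_Suc Suc_eq_plus1 [symmetric] by linarith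
  then show ?thesis
    unfolding derived_series_eq_tail by (rule tail_eq_zero_iff)
qed

lemma lower_central_series_subset_tail: "lower_central_series L bracket i \<subseteq> tail (Suc i)"
proof (induction i)
  case 0
  show ?case by (simp add: carrier_eq_tail)
next
  case (Suc i)
  have "1 \<le> Suc i" by simp
  have "lower_central_series L bracket (Suc i) \<subseteq> lie_product bracket (tail 1) (tail (Suc i))"
    using Suc carrier_eq_tail by (auto simp: lie_product_def intro!: span_mono)
  also have "\<dots> \<subseteq> tail (Suc (Suc i))"
    unfolding lie_product_tail_eq_span [OF order.refl \<open>1 \<le> Suc i\<close>]
    by (intro span_minimal subspace_tail) (auto intro!: bracket_basis_in_tail)
  finally show ?case .
qed

lemma nilpotent: "lie_nilpotent L bracket"
proof -
  have "lower_central_series L bracket n \<subseteq> {0}"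
    using lower_central_series_subset_tail [of n] tail_eq_zero_iff [of "Suc n"] by simp
  moreover have "subspace (lower_central_series L bracket n)"
    by (cases n) (simp_all add: carrier_subspace lie_product_def)
  ultimately have "lower_central_series L bracket n = {0}"
    using subspace_0 by blast
  then show ?thesis
    unfolding lie_nilpotent_def by blast
qed

lemma solvable_of_step_iff:
  assumes "1 \<le> n"
  shows "solvable_of_step L bracket k \<longleftrightarrow> 2 ^ k - 1 \<le> n \<and> n < 2 ^ (k + 1) - 1"
proof (cases k)
  case 0
  then show ?thesis using assms by (simp add: solvable_of_step_def)
next
  case (Suc i)
  then show ?thesis
    unfolding solvable_of_step_def derived_series_eq_zero_iff by (simp add: not_less conj_commute)
qed

end

lemma unique_power_two_interval:
  fixes n :: nat
  shows "\<exists>!k. 2 ^ k - 1 \<le> n \<and> n < 2 ^ (k + 1) - 1"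
proof -
  \<comment> \<open>In terms of \<open>n + 1\<close> the bounds say that \<open>k\<close> is the position of its leading binary digit.\<close>
  have shift: "2 ^ k - 1 \<le> n \<and> n < 2 ^ (k + 1) - 1 \<longleftrightarrow> 2 ^ k \<le> n + 1 \<and> n + 1 < 2 ^ (k + 1)" for k
    by auto
  obtain k where "2 ^ k \<le> n + 1" "n + 1 < 2 ^ (k + 1)"
    using ex_power_ivl1 [of 2 "n + 1"] by auto
  moreover have "k \<le> k'" if "2 ^ k \<le> n + 1" "n + 1 < 2 ^ (k' + 1)" for k k'
  proof -
    have "(2::nat) ^ k < 2 ^ (k' + 1)" using that by linarith
    then show ?thesis
      using power_less_imp_less_exp [of "2::nat" k "k' + 1"] by simp
  qed
  ultimately show ?thesis
    unfolding shift by (blast intro: antisym)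
qed

theorem theorem3:
  fixes \<V> :: "'a::real_vector set" and bracket :: "'a \<Rightarrow> 'a \<Rightarrow> 'a"
    and e :: "nat \<Rightarrow> 'a" and n :: nat
  assumes "1 \<le> n"
    and "V_algebra \<V> bracket n e"
  shows "lie_nilpotent \<V> bracket \<and>
    (\<exists>!k. 2 ^ k - 1 \<le> n \<and> n < 2 ^ (k + 1) - 1) \<and>
    (\<forall>k. 2 ^ k - 1 \<le> n \<and> n < 2 ^ (k + 1) - 1 \<longrightarrow> solvable_of_step \<V> bracket k)"
proof -
  interpret V_algebra \<V> bracket n e by (rule assms(2))
  show ?thesis
    using nilpotent unique_power_two_interval solvable_of_step_iff [OF assms(1)] by blast
qed

end
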